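(* Let $R$ be a finite commutative ring with unity and let $\Gamma'(R)$ be the unity product graph associated with $R$. Then $\Gamma'(R)$ is planar.
   Context: For a ring $R$ with unity $e$, let $U(R)$ denote the set of units of $R$. The unity product graph $\Gamma'(R)$ is the simple graph with vertex set $U(R)$ in which two distinct vertices $r_i,r_j$ are adjacent if and only if $r_i\cdot r_j=e$. A graph is planar if it can be drawn in the plane such that no two of its edges cross; equivalently (Kuratowski's theorem), if it does not contain a subdivision of $K_5$ or $K_{3,3}$ as a subgraph. *)

theory Defs
  imports "HOL-Analysis.Analysis" "HOL-Algebra.Ring" "Graph_Theory.Pair_Digraph"
begin

(* As usual in Graph_Theory, a simple graph is a loop-free symmetric digraph without parallel
   arcs: the undirected edge {u, v} is the pair of arcs (u, v), (v, u). *)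

definition unity_product_graph :: "('a, 'b) ring_scheme \<Rightarrow> 'a pair_pre_digraph" where
  "unity_product_graph R =
     \<lparr> pverts = Units R,
       parcs = {(x, y). x \<in> Units R \<and> y \<in> Units R \<and> x \<noteq> y \<and> x \<otimes>\<^bsub>R\<^esub> y = \<one>\<^bsub>R\<^esub>} \<rparr>"

lemma pair_graph_unity_product_graph:
  fixes R :: "('a, 'b) ring_scheme"
  assumes "ring R" and "finite (carrier R)"
  shows "pair_graph (unity_product_graph R)"
proof -
  interpret ring R by fact
  have fin: "finite (Units R)"
    by (rule finite_subset[OF _ assms(2)]) (auto dest: Units_closed)
  have "finite {(x, y). x \<in> Units R \<and> y \<in> Units R \<and> x \<noteq> y \<and> x \<otimes>\<^bsub>R\<^esub> y = \<one>\<^bsub>R\<^esub>}"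
    by (rule finite_subset[of _ "Units R \<times> Units R"]) (use fin in auto)
  moreover have "y \<otimes>\<^bsub>R\<^esub> x = \<one>\<^bsub>R\<^esub>"
    if "x \<in> Units R" "y \<in> Units R" "x \<otimes>\<^bsub>R\<^esub> y = \<one>\<^bsub>R\<^esub>" for x y
    using that by (metis Units_inv_comm Units_closed)
  ultimately show ?thesis
    using fin
    by unfold_locales (auto simp: unity_product_graph_def symmetric_def intro: symI)
qed

(* A drawing in the plane, identified with the complex numbers. The point p v represents the
   vertex v. The map \<gamma> is indexed by two-element sets, so that an undirected edge is drawn once,
   as a Jordan arc joining the points of its two ends; which end the parametrisation starts from
   is irrelevant. An edge passes through no vertex other than its ends, and two distinct edges
   share no point other than a common end. *)
definition planar_drawing ::
  "'v pair_pre_digraph \<Rightarrow> ('v \<Rightarrow> complex) \<Rightarrow> ('v set \<Rightarrow> real \<Rightarrow> complex) \<Rightarrow> bool" where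
  "planar_drawing G p \<gamma> \<longleftrightarrow>
     inj_on p (pverts G) \<and>
     (\<forall>(u, v) \<in> parcs G.
        arc (\<gamma> {u, v}) \<and>
        {pathstart (\<gamma> {u, v}), pathfinish (\<gamma> {u, v})} = {p u, p v} \<and>
        path_image (\<gamma> {u, v}) \<inter> p ` pverts G \<subseteq> {p u, p v}) \<and>
     (\<forall>(u, v) \<in> parcs G. \<forall>(x, y) \<in> parcs G. {u, v} \<noteq> {x, y} \<longrightarrow>
        path_image (\<gamma> {u, v}) \<inter> path_image (\<gamma> {x, y}) \<subseteq> p ` ({u, v} \<inter> {x, y}))"

definition planar :: "'v pair_pre_digraph \<Rightarrow> bool" where
  "planar G \<longleftrightarrow> (\<exists>p \<gamma>. planar_drawing G p \<gamma>)"

end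

theory Submission
  imports Defs
begin

text \<open>
  A unit \<open>r\<close> is adjacent to at most one vertex, namely its inverse, because inverses in a monoid
  are unique. Hence the unity product graph is a matching together with isolated vertices (the
  units with \<open>r\<^sup>2 = 1\<close>), and every finite graph of this kind can be drawn with straight,
  pairwise disjoint segments.
\<close>

text \<open>
  Choose distinct real heights \<open>h v\<close> for the vertices, and put \<open>v\<close> at height \<open>h v\<close> on the vertical
  line whose abscissa is the smallest height in the connected component of \<open>v\<close>. Different
  components then lie on different, hence disjoint, vertical lines, and an edge is the vertical
  segment between its two ends.
\<close>

lemma planar_of_unique_neighbour:
  assumes "pair_graph G"
    and unique: "\<And>u v w. (u, v) \<in> parcs G \<Longrightarrow> (u, w) \<in> parcs G \<Longrightarrow> v = w"
  shows "planar G"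
proof -
  interpret pair_graph G by fact
  obtain k :: "'a \<Rightarrow> nat" where "inj_on k (pverts G)"
    using finite_imp_inj_to_nat_seg[of "pverts G"] by auto
  define h where "h v = real (k v)" for v
  have inj: "inj_on h (pverts G)"
    using \<open>inj_on k (pverts G)\<close> by (auto simp: h_def inj_on_def)
  \<comment> \<open>Since no vertex has two neighbours, this is the connected component of \<open>v\<close>.\<close>
  define C where "C v = insert v {w. (v, w) \<in> parcs G}" for v
  define p where "p v = Complex (Min (h ` C v)) (h v)" for v
  \<comment> \<open>Always drawn upwards, so that the arc depends only on the set of ends.\<close>
  define \<gamma> where "\<gamma> S = linepath (Complex (Min (h ` S)) (Min (h ` S)))
                               (Complex (Min (h ` S)) (Max (h ` S)))" for S
  have C_edge: "C u = {u, v}" "C v = {u, v}" if "(u, v) \<in> parcs G" for u v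
    using that unique arcs_symmetric by (auto simp: C_def)
  have ends: "u \<in> pverts G" "v \<in> pverts G" "u \<noteq> v" "h u \<noteq> h v" if "(u, v) \<in> parcs G" for u v
    using that in_arcsD1[of u v] in_arcsD2[of u v] no_loops' inj by (auto simp: inj_on_def)
  have C_sub: "C v \<subseteq> pverts G" and C_fin: "finite (C v)" if "v \<in> pverts G" for v
  proof -
    show "C v \<subseteq> pverts G"
      using that ends(2) by (auto simp: C_def)
    then show "finite (C v)"
      using finite_subset pair_finite_verts by blast
  qed
  \<comment> \<open>The abscissa of a component determines the vertex that attains it, hence the component.\<close>
  have abscissa: "C v \<inter> C w \<noteq> {}"
    if vw: "v \<in> pverts G" "w \<in> pverts G" "Min (h ` C v) = Min (h ` C w)" for v w
  proof -
    have attained: "\<exists>a\<in>C x. Min (h ` C x) = h a" if "x \<in> pverts G" for x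
      using Min_in[of "h ` C x"] C_fin[OF that] by (auto simp: C_def)
    obtain a b where ab: "a \<in> C v" "b \<in> C w" and "h a = h b"
      using attained[OF vw(1)] attained[OF vw(2)] vw(3) by auto
    then have "a = b"
      using inj_onD[OF inj, of a b] C_sub[OF vw(1)] C_sub[OF vw(2)] by blast
    with ab show ?thesis by auto
  qed
  have Re_edge: "Re z = Min (h ` {u, v})" if "z \<in> path_image (\<gamma> {u, v})" for u v z
    using that by (simp add: \<gamma>_def closed_segment_same_Re)
  have "planar_drawing G p \<gamma>"
    unfolding planar_drawing_def
  proof (intro conjI ballI, goal_cases)
    case 1
    show ?case
      using inj by (auto simp: inj_on_def p_def)
  next
    case (2 e)
    obtain u v where e: "e = (u, v)" by fastforce
    with 2 have uv: "(u, v) \<in> parcs G" by simp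
    note uv_ends = ends[OF uv]
    have "Path_Connected.arc (\<gamma> {u, v})"
      using uv_ends by (auto simp: \<gamma>_def min_def max_def)
    moreover have "{pathstart (\<gamma> {u, v}), pathfinish (\<gamma> {u, v})} = {p u, p v}"
      by (auto simp: \<gamma>_def p_def C_edge[OF uv] min_def max_def)
    moreover have "p w \<in> {p u, p v}" if "w \<in> pverts G" "p w \<in> path_image (\<gamma> {u, v})" for w
    proof -
      have "C w \<inter> {u, v} \<noteq> {}"
        using abscissa[of w u] Re_edge[OF that(2)] that(1) uv_ends
        by (simp add: p_def C_edge[OF uv])
      then have "w \<in> {u, v}"
        using C_edge[OF uv] arcs_symmetric[of w u] arcs_symmetric[of w v]
        unfolding C_def by auto
      then show ?thesis by auto
    qed
    ultimately show ?case
      unfolding e by auto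
  next
    case (3 e)
    have "{u, v} = {x, y}"
      if uv: "(u, v) \<in> parcs G" and xy: "(x, y) \<in> parcs G"
        and z: "z \<in> path_image (\<gamma> {u, v})" "z \<in> path_image (\<gamma> {x, y})" for u v x y z
    proof -
      have "{u, v} \<inter> {x, y} \<noteq> {}"
        using abscissa[of u x] Re_edge[OF z(1)] Re_edge[OF z(2)] ends[OF uv] ends[OF xy]
        by (simp add: C_edge[OF uv] C_edge[OF xy])
      then show ?thesis
        using C_edge[OF uv] C_edge[OF xy] by auto
    qed
    with 3 show ?case
      by blast
  qed
  then show ?thesis
    unfolding planar_def by blast
qed

theorem theorem6p1:
  fixes R :: "('a, 'b) ring_scheme"
  assumes "cring R"
    and "finite (carrier R)"
  shows "planar (unity_product_graph R)"
proof (rule planar_of_unique_neighbour)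
  interpret cring R by fact
  show "pair_graph (unity_product_graph R)"
    using ring_axioms assms(2) by (rule pair_graph_unity_product_graph)
  show "v = w"
    if "(u, v) \<in> parcs (unity_product_graph R)" "(u, w) \<in> parcs (unity_product_graph R)" for u v w
    using that inv_unique[of v u w] m_comm[of u v]
    by (auto simp: unity_product_graph_def)
qed

end
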